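(* Let $P_n$ be a path of order $n$. Then $$DI(P_n)=\begin{cases} k(3k+2) & \text{for } n=3k,\\ (3k+1)(k+1) & \text{for } n=3k+1,\\ k(k+2)+2(k+1)^2 & \text{for } n=3k+2.\end{cases}$$
   Context: A dominating set of a finite simple graph $G$ is a set $D\subseteq V(G)$ such that every vertex in $V(G)\setminus D$ is adjacent to some vertex of $D$. A minimal dominating set is a dominating set that does not properly contain any other dominating set. The domination degree of a vertex $a$ is $d_d(a)=\min\{|D| : D \text{ is a minimal dominating set of } G \text{ with } a\in D\}$. The domination index of $G$ is $DI(G)=\sum_{a\in V(G)}d_d(a)$. The order of a graph is its number of vertices; $n\ge 1$ and $k$ is a nonnegative integer. *)

theory Defs
  imports "Graph_Theory.Pair_Digraph"
begin

text \<open>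
  A finite simple graph is represented by a finite, symmetric, loop-free relation on its vertex
  set (locale \<^locale>\<open>pair_graph\<close>); each edge is the pair of its two opposite arcs.
\<close>

definition dominating_set :: "'a pair_pre_digraph \<Rightarrow> 'a set \<Rightarrow> bool" where
  "dominating_set G D \<longleftrightarrow>
     D \<subseteq> pverts G \<and> (\<forall>v \<in> pverts G - D. \<exists>u \<in> D. (u, v) \<in> parcs G)"

definition minimal_dominating_set :: "'a pair_pre_digraph \<Rightarrow> 'a set \<Rightarrow> bool" where
  "minimal_dominating_set G D \<longleftrightarrow>
     dominating_set G D \<and> \<not> (\<exists>D'. dominating_set G D' \<and> D' \<subset> D)"

text \<open>
  For a vertex of a finite simple graph the set below is finite and nonempty, so \<^const>\<open>Min\<close> is
  the genuine minimum: a maximal independent set containing \<open>a\<close> is a minimal dominating set.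
\<close>

definition domination_degree :: "'a pair_pre_digraph \<Rightarrow> 'a \<Rightarrow> nat" where
  "domination_degree G a = Min {card D |D. minimal_dominating_set G D \<and> a \<in> D}"

definition domination_index :: "'a pair_pre_digraph \<Rightarrow> nat" where
  "domination_index G = (\<Sum>a \<in> pverts G. domination_degree G a)"

definition path_graph :: "nat \<Rightarrow> 'a pair_pre_digraph \<Rightarrow> bool" where
  "path_graph n G \<longleftrightarrow> pair_graph G \<and>
     (\<exists>vs. distinct vs \<and> length vs = n \<and> pverts G = set vs \<and>
        parcs G = {(vs ! i, vs ! Suc i) |i. Suc i < n} \<union> {(vs ! Suc i, vs ! i) |i. Suc i < n})"

text \<open>There is a path of every order.\<close>

lemma path_graph_nat:
  "path_graph n \<lparr>pverts = {..<n},
     parcs = {(i, Suc i) |i. Suc i < n} \<union> {(Suc i, i) |i. Suc i < n}\<rparr>"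
  (is "path_graph n ?G")
proof -
  have "finite (parcs ?G)"
    by (rule finite_subset[of _ "{..<n} \<times> {..<n}"]) auto
  then have graph: "pair_graph ?G"
    by unfold_locales (auto simp: symmetric_def intro!: symI)
  have nth: "[0..<n] ! i = i" "[0..<n] ! Suc i = Suc i" if "Suc i < n" for i
    using that by simp_all
  have arcs: "parcs ?G = {([0..<n] ! i, [0..<n] ! Suc i) |i. Suc i < n} \<union>
      {([0..<n] ! Suc i, [0..<n] ! i) |i. Suc i < n}"
    unfolding pair_pre_digraph.simps
    by (intro arg_cong2[where f = "(\<union>)"] Collect_cong) (metis nth)+
  show ?thesis
    unfolding path_graph_def
    using graph arcs by (intro conjI exI[of _ "[0..<n]"]) (auto simp only: pair_pre_digraph.simps
      distinct_upt length_upt set_upt lessThan_atLeast0 diff_zero)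
qed

end

theory Submission
  imports Defs
begin

text \<open>
  On a path with vertices numbered \<open>0, \<dots>, n - 1\<close>, the vertex \<open>j\<close> has domination degree
  \<open>1 + (j + 1) div 3 + (n - j) div 3\<close>: besides \<open>j\<close> itself, one vertex is spent on every three
  vertices of each of the two stretches, of \<open>j - 1\<close> and \<open>n - j - 2\<close> vertices (none if this is
  negative), that \<open>j\<close> does not dominate, rounded up.

  The lower bound is a packing argument (\<open>card_ge_if_dominating\<close>). The vertices \<open>0, 3, 6, \<dots>\<close> up to
  \<open>j - 2\<close> and \<open>n - 1, n - 4, \<dots>\<close> down to \<open>j + 2\<close> have pairwise disjoint closed neighbourhoods, none
  of which contains \<open>j\<close>. A dominating set meets each of them, so one that contains \<open>j\<close> has at least
  one element more than there are such vertices.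

  For the upper bound (\<open>ex_minimal_dominating_set\<close>), go from \<open>j\<close> in steps of three in both
  directions and, where the last step would overshoot the end of the path by exactly one, take the
  end vertex instead. Consecutive chosen vertices are at distance two or three, so the set is
  independent and dominating, hence a \<^emph>\<open>minimal\<close> dominating set. Independence is what makes this
  work for every \<open>j\<close>: shrinking an arbitrary dominating set to a minimal one might lose \<open>j\<close>.

  Summing over \<open>j\<close>, the two quotients contribute equally by the reflection \<open>j \<mapsto> n - 1 - j\<close>. Hence the
  index is \<open>n + 2 * (\<Sum>i=1..n. i div 3)\<close>, which yields the three closed forms.
\<close>

section \<open>Independent dominating sets\<close>

text \<open>A vertex removed from an independent set has no neighbour among those that remain.\<close>

lemma minimal_dominating_set_if_independent:
  assumes "dominating_set G D" and "\<And>u v. u \<in> D \<Longrightarrow> v \<in> D \<Longrightarrow> (u, v) \<notin> parcs G"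
  shows "minimal_dominating_set G D"
  using assms unfolding minimal_dominating_set_def dominating_set_def by blast

section \<open>Domination on a numbered path\<close>

locale numbered_path =
  fixes G :: "'a pair_pre_digraph" and vs :: "'a list" and n :: nat
  assumes distinct: "distinct vs" and length: "length vs = n" and pverts: "pverts G = set vs"
    and parcs: "parcs G =
      {(vs ! i, vs ! Suc i) |i. Suc i < n} \<union> {(vs ! Suc i, vs ! i) |i. Suc i < n}"
begin

lemma nth_inject: "i < n \<Longrightarrow> j < n \<Longrightarrow> vs ! i = vs ! j \<longleftrightarrow> i = j"
  by (simp add: distinct length nth_eq_iff_index_eq)

lemma bij_betw_nth: "bij_betw ((!) vs) {..<n} (pverts G)"
  using distinct length pverts by (simp add: bij_betw_nth)

lemma pverts_image: "pverts G = (!) vs ` {..<n}"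
  using bij_betw_nth by (simp add: bij_betw_def)

lemma nth_in_image_iff: "v < n \<Longrightarrow> I \<subseteq> {..<n} \<Longrightarrow> vs ! v \<in> (!) vs ` I \<longleftrightarrow> v \<in> I"
  using nth_inject by blast

lemma card_image_nth: "I \<subseteq> {..<n} \<Longrightarrow> card ((!) vs ` I) = card I"
  by (meson bij_betw_def bij_betw_nth card_image inj_on_subset)

lemma arc_iff:
  assumes "i < n" "j < n"
  shows "(vs ! i, vs ! j) \<in> parcs G \<longleftrightarrow> j = Suc i \<or> i = Suc j"
proof
  assume "(vs ! i, vs ! j) \<in> parcs G"
  then show "j = Suc i \<or> i = Suc j"
    unfolding parcs using assms nth_inject by (auto dest: Suc_lessD)
next
  assume "j = Suc i \<or> i = Suc j"
  then show "(vs ! i, vs ! j) \<in> parcs G"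
    unfolding parcs using assms by auto
qed

lemma dominating_set_image_iff:
  assumes "I \<subseteq> {..<n}"
  shows "dominating_set G ((!) vs ` I) \<longleftrightarrow> (\<forall>v<n. \<exists>i\<in>I. i \<le> Suc v \<and> v \<le> Suc i)"
proof -
  have "dominating_set G ((!) vs ` I) \<longleftrightarrow>
      (\<forall>v<n. v \<notin> I \<longrightarrow> (\<exists>i\<in>I. (vs ! i, vs ! v) \<in> parcs G))"
    unfolding dominating_set_def pverts_image using assms nth_in_image_iff[OF _ assms] by auto
  also have "\<dots> \<longleftrightarrow> (\<forall>v<n. v \<notin> I \<longrightarrow> (\<exists>i\<in>I. v = Suc i \<or> i = Suc v))"
    using assms arc_iff by (meson lessThan_iff subset_iff)
  also have "\<dots> \<longleftrightarrow> (\<forall>v<n. \<exists>i\<in>I. i \<le> Suc v \<and> v \<le> Suc i)"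
  proof -
    have "v = i \<or> v = Suc i \<or> i = Suc v \<longleftrightarrow> i \<le> Suc v \<and> v \<le> Suc i" for v i :: nat
      by linarith
    then show ?thesis by metis
  qed
  finally show ?thesis .
qed

section \<open>The domination degree of a vertex of a path\<close>

text \<open>
  The packing is \<open>L \<union> R\<close> below. Its members are at distance at least three from each other and at
  least two from \<open>j\<close>, so the dominators \<open>f v\<close> that are chosen for them, each within distance one,
  are pairwise different and different from \<open>j\<close>.
\<close>

lemma card_ge_if_dominating:
  assumes D: "dominating_set G ((!) vs ` I)" and I: "I \<subseteq> {..<n}" and j: "j \<in> I"
  shows "1 + (j + 1) div 3 + (n - j) div 3 \<le> card I"
proof -
  obtain f where f: "\<And>v. v < n \<Longrightarrow> f v \<in> I \<and> f v \<le> Suc v \<and> v \<le> Suc (f v)"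
    using D unfolding dominating_set_image_iff[OF I] by metis
  define L where "L = (\<lambda>a. 3 * a) ` {..<(j + 1) div 3}"
  define R where "R = (\<lambda>b. n - 1 - 3 * b) ` {..<(n - j) div 3}"
  have "j < n" using I j by blast
  have L: "v + 2 \<le> j" "3 dvd v" if "v \<in> L" for v
    using that unfolding L_def by auto
  have R: "j + 2 \<le> v" "v < n" "3 dvd n - 1 - v" if "v \<in> R" for v
    using that \<open>j < n\<close> unfolding R_def by auto
  have apart: "u = v \<or> u + 3 \<le> v \<or> v + 3 \<le> u" if "u \<in> L \<union> R" "v \<in> L \<union> R" for u v
  proof -
    have *: "u = v \<or> u + 3 \<le> v \<or> v + 3 \<le> u" if "3 dvd u" "3 dvd v" for u v :: nat
      using that by presburger
    moreover have "u = v \<or> u + 3 \<le> v \<or> v + 3 \<le> u"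
      if "3 dvd n - 1 - u" "3 dvd n - 1 - v" "u < n" "v < n" for u v
      using *[OF that(1,2)] that(3,4) by linarith
    moreover have "u + 3 \<le> v" if "u \<in> L" "v \<in> R" for u v
      using L(1)[OF that(1)] R(1)[OF that(2)] by linarith
    ultimately show ?thesis using that L(2) R(2,3) by (metis UnE)
  qed
  have less: "v < n" if "v \<in> L \<union> R" for v
    using that L R \<open>j < n\<close> by fastforce
  have "inj_on f (L \<union> R)"
  proof (rule inj_onI)
    fix u v assume "u \<in> L \<union> R" "v \<in> L \<union> R" "f u = f v"
    then show "u = v"
      using apart[of u v] f[OF less, of u] f[OF less, of v] by linarith
  qed
  moreover have "L \<inter> R = {}" using L R by fastforce
  moreover have "card L = (j + 1) div 3"
    unfolding L_def by (subst card_image) (auto simp: inj_on_def)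
  moreover have "card R = (n - j) div 3"
    unfolding R_def by (subst card_image) (auto simp: inj_on_def)
  moreover have "finite L" "finite R" by (auto simp: L_def R_def)
  ultimately have "card (f ` (L \<union> R)) = (j + 1) div 3 + (n - j) div 3"
    by (simp add: card_image card_Un_disjoint)
  moreover have "j \<notin> f ` (L \<union> R)"
  proof
    assume "j \<in> f ` (L \<union> R)"
    then obtain v where v: "v \<in> L \<union> R" "j = f v" by blast
    then show False using L(1)[of v] R(1)[of v] f[OF less[OF v(1)]] by fastforce
  qed
  ultimately have "card (insert j (f ` (L \<union> R))) = 1 + (j + 1) div 3 + (n - j) div 3"
    using \<open>finite L\<close> \<open>finite R\<close> by simp
  moreover have "insert j (f ` (L \<union> R)) \<subseteq> I"
    using j f less by blast
  ultimately show ?thesis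
    using card_mono[OF finite_subset[OF I finite_lessThan]] by metis
qed

text \<open>
  The truncated difference and the minimum produce the end vertex of the path when the last step
  of three overshoots it by one.
\<close>

lemma ex_minimal_dominating_set:
  assumes "j < n"
  obtains I where "I \<subseteq> {..<n}" "j \<in> I" "minimal_dominating_set G ((!) vs ` I)"
    "card I \<le> 1 + (j + 1) div 3 + (n - j) div 3"
proof
  define L where "L = (\<lambda>a. j - (3 * a + 3)) ` {..<(j + 1) div 3}"
  define R where "R = (\<lambda>b. min (n - 1) (j + (3 * b + 3))) ` {..<(n - j) div 3}"
  let ?I = "insert j (L \<union> R)"
  \<comment> \<open>In this form of membership, independence and domination are Presburger arithmetic.\<close>
  have L: "i \<in> L \<longleftrightarrow> i < j \<and> (3 dvd j - i \<or> i = 0 \<and> 3 dvd j + 1)" for i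
  proof
    have range: "a < (j + 1) div 3 \<longleftrightarrow> 3 * a + 3 \<le> j + 1" for a by presburger
    {
      assume "i \<in> L"
      then obtain a where a: "i = j - (3 * a + 3)" "3 * a + 3 \<le> j + 1"
        by (auto simp: L_def range)
      then have "i < j \<and> (j - i = 3 * (a + 1) \<or> i = 0 \<and> j + 1 = 3 * (a + 1))" by arith
      then show "i < j \<and> (3 dvd j - i \<or> i = 0 \<and> 3 dvd j + 1)"
        using dvd_triv_left by metis
    next
      assume i: "i < j \<and> (3 dvd j - i \<or> i = 0 \<and> 3 dvd j + 1)"
      then obtain c where "j - i = 3 * c \<or> i = 0 \<and> j + 1 = 3 * c" by (auto simp: dvd_def)
      with i have "i = j - (3 * (c - 1) + 3) \<and> 3 * (c - 1) + 3 \<le> j + 1" by (cases c) auto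
      then show "i \<in> L" unfolding L_def using range by blast
    }
  qed
  have R: "i \<in> R \<longleftrightarrow> j < i \<and> i < n \<and> (3 dvd i - j \<or> Suc i = n \<and> 3 dvd Suc i - j)" for i
  proof
    have range: "b < (n - j) div 3 \<longleftrightarrow> j + (3 * b + 3) \<le> n" for b using assms by presburger
    {
      assume "i \<in> R"
      then obtain b where b: "i = min (n - 1) (j + (3 * b + 3))" "j + (3 * b + 3) \<le> n"
        by (auto simp: R_def range)
      then have "j < i \<and> i < n \<and>
          (i - j = 3 * (b + 1) \<or> Suc i = n \<and> Suc i - j = 3 * (b + 1))"
        using assms by (cases "j + (3 * b + 3) = n") auto
      then show "j < i \<and> i < n \<and> (3 dvd i - j \<or> Suc i = n \<and> 3 dvd Suc i - j)"
        using dvd_triv_left by metis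
    next
      assume i: "j < i \<and> i < n \<and> (3 dvd i - j \<or> Suc i = n \<and> 3 dvd Suc i - j)"
      then obtain c where "i - j = 3 * c \<or> Suc i = n \<and> Suc i - j = 3 * c" by (auto simp: dvd_def)
      with i have "i = min (n - 1) (j + (3 * (c - 1) + 3)) \<and> j + (3 * (c - 1) + 3) \<le> n"
        by (cases c) auto
      then show "i \<in> R" unfolding R_def using range by blast
    }
  qed
  show I: "?I \<subseteq> {..<n}" using assms by (auto simp: L R)
  show "j \<in> ?I" by simp
  have "\<exists>i\<in>?I. i \<le> Suc v \<and> v \<le> Suc i" if "v < n" for v
  proof -
    consider "v < j" | "v = j" | "j < v" by linarith
    then show ?thesis
    proof cases
      case 1
      \<comment> \<open>One of \<open>v\<close>, \<open>v + 1\<close>, \<open>v - 1\<close> is congruent to \<open>j\<close> modulo 3; if \<open>v - 1\<close> would precede the path,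
        then \<open>v = 0\<close> has been put in as the end vertex.\<close>
      then have "3 dvd j - v \<or> 3 dvd j - Suc v \<or> 3 dvd j + 1 - v" by presburger
      then consider "3 dvd j - v \<or> v = 0 \<and> 3 dvd j + 1" | "3 dvd j - Suc v"
        | "0 < v" "3 dvd j - (v - 1)"
        by (cases v) auto
      then show ?thesis
      proof cases
        case 1
        with \<open>v < j\<close> show ?thesis by (intro bexI[of _ v]) (auto simp: L)
      next
        case 2
        with \<open>v < j\<close> show ?thesis by (intro bexI[of _ "Suc v"]) (auto simp: L)
      next
        case 3
        with \<open>v < j\<close> show ?thesis by (intro bexI[of _ "v - 1"]) (auto simp: L)
      qed
    next
      case 3
      then have "3 dvd v - j \<or> 3 dvd (v - 1) - j \<or> 3 dvd Suc v - j" by presburger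
      with \<open>v < n\<close> consider "3 dvd v - j \<or> Suc v = n \<and> 3 dvd Suc v - j"
        | "3 dvd (v - 1) - j" | "Suc v < n" "3 dvd Suc v - j"
        using Suc_lessI by blast
      then show ?thesis
      proof cases
        case 1
        with \<open>j < v\<close> \<open>v < n\<close> show ?thesis by (intro bexI[of _ v]) (auto simp: R)
      next
        case 2
        with \<open>j < v\<close> \<open>v < n\<close> show ?thesis by (intro bexI[of _ "v - 1"]) (auto simp: R)
      next
        case 3
        with \<open>j < v\<close> show ?thesis by (intro bexI[of _ "Suc v"]) (auto simp: R)
      qed
    qed auto
  qed
  then have "dominating_set G ((!) vs ` ?I)"
    unfolding dominating_set_image_iff[OF I] by blast
  moreover have "(u, v) \<notin> parcs G" if uv: "u \<in> (!) vs ` ?I" "v \<in> (!) vs ` ?I" for u v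
  proof -
    from uv obtain a b where ab: "a \<in> ?I" "b \<in> ?I" "u = vs ! a" "v = vs ! b" by blast
    have apart: "Suc x \<notin> ?I" if "x \<in> ?I" for x
    proof -
      consider "Suc x < j" | "Suc x = j" | "x = j" | "j < x" by linarith
      then show ?thesis
      proof cases
        case 1
        then have "\<not> (3 dvd j - x \<and> 3 dvd j - Suc x)" by presburger
        moreover have "\<not> (3 dvd j + 1 \<and> 3 dvd j - 1)" by presburger
        ultimately show ?thesis using 1 that by (auto simp: L R)
      next
        case 2
        with that show ?thesis by (auto simp: L R) presburger
      next
        case 3
        moreover have "\<not> 3 dvd Suc (Suc 0)" by presburger
        ultimately show ?thesis by (auto simp: L R Suc_diff_le)
      next
        case 4
        then have "\<not> (3 dvd x - j \<and> (3 dvd Suc x - j \<or> 3 dvd Suc (Suc x) - j))" by presburger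
        with 4 that show ?thesis by (auto simp: L R)
      qed
    qed
    show ?thesis
      using ab I arc_iff[of a b] apart by (metis lessThan_iff subset_iff)
  qed
  ultimately show "minimal_dominating_set G ((!) vs ` ?I)"
    by (rule minimal_dominating_set_if_independent)
  have "card L \<le> (j + 1) div 3" "card R \<le> (n - j) div 3"
    unfolding L_def R_def by (metis card_image_le card_lessThan finite_lessThan)+
  moreover have "card (insert j (L \<union> R)) \<le> Suc (card L + card R)"
    using card_Un_le[of L R] card_insert_le_m1[of "Suc (card L + card R)" "L \<union> R" j] by simp
  ultimately show "card ?I \<le> 1 + (j + 1) div 3 + (n - j) div 3" by linarith
qed

lemma domination_degree_nth:
  assumes "j < n"
  shows "domination_degree G (vs ! j) = 1 + (j + 1) div 3 + (n - j) div 3"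
  unfolding domination_degree_def
proof (rule Min_eqI)
  let ?C = "{card D |D. minimal_dominating_set G D \<and> vs ! j \<in> D}"
  have sub: "D \<subseteq> pverts G" if "minimal_dominating_set G D" for D
    using that by (simp add: minimal_dominating_set_def dominating_set_def)
  have "finite (pverts G)" by (simp add: pverts)
  then show "finite ?C"
    using sub by (intro finite_subset[of ?C "{..card (pverts G)}"]) (auto intro: card_mono)
  have ge: "1 + (j + 1) div 3 + (n - j) div 3 \<le> card D"
    if D: "minimal_dominating_set G D" "vs ! j \<in> D" for D
  proof -
    obtain I where I: "I \<subseteq> {..<n}" "D = (!) vs ` I"
      using sub[OF D(1)] unfolding pverts_image by (meson subset_imageE)
    have "j \<in> I" using D(2) I assms nth_in_image_iff by blast
    then show ?thesis
      using card_ge_if_dominating[OF _ I(1)] card_image_nth[OF I(1)] D(1) I(2)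
      by (simp add: minimal_dominating_set_def)
  qed
  then show "1 + (j + 1) div 3 + (n - j) div 3 \<le> c" if "c \<in> ?C" for c
    using that by blast
  obtain I where I: "I \<subseteq> {..<n}" "j \<in> I" "minimal_dominating_set G ((!) vs ` I)"
      "card I \<le> 1 + (j + 1) div 3 + (n - j) div 3"
    using ex_minimal_dominating_set[OF assms] .
  then have "card ((!) vs ` I) = 1 + (j + 1) div 3 + (n - j) div 3"
    using ge[OF I(3)] card_image_nth[OF I(1)] by (simp add: imageI)
  then show "1 + (j + 1) div 3 + (n - j) div 3 \<in> ?C"
    using I(2,3) by (metis (mono_tags, lifting) CollectI imageI)
qed

section \<open>Summation\<close>

lemma domination_index_eq: "domination_index G = n + 2 * (\<Sum>i<n. (i + 1) div 3)"
proof -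
  have "domination_index G = (\<Sum>j<n. domination_degree G (vs ! j))"
    unfolding domination_index_def by (rule sum.reindex_bij_betw[OF bij_betw_nth, symmetric])
  also have "\<dots> = (\<Sum>j<n. 1 + (j + 1) div 3 + (n - j) div 3)"
    by (intro sum.cong) (auto simp: domination_degree_nth)
  also have "\<dots> = n + (\<Sum>j<n. (j + 1) div 3) + (\<Sum>j<n. (n - j) div 3)"
    by (simp only: sum.distrib sum_constant card_lessThan of_nat_id mult_1_right)
  also have "(\<Sum>j<n. (n - j) div 3) = (\<Sum>j<n. (j + 1) div 3)"
    by (subst sum.nat_diff_reindex[symmetric]) (auto intro!: sum.cong simp: Suc_diff_Suc)
  finally show ?thesis by simp
qed

end

text \<open>The summands come in blocks \<open>q, q, q + 1\<close>, one block for each \<open>q < k\<close>.\<close>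

lemma sum_Suc_div_3: "2 * (\<Sum>i<3 * k. (i + 1) div 3) + k = 3 * k * (k::nat)"
proof (induction k)
  case (Suc k)
  have "3 * Suc k = Suc (Suc (Suc (3 * k)))" by simp
  then have "(\<Sum>i<3 * Suc k. (i + 1) div 3) = (\<Sum>i<3 * k. (i + 1) div 3) +
      (3 * k + 1) div 3 + (3 * k + 2) div 3 + (3 * k + 3) div 3"
    by (simp only: sum.lessThan_Suc) simp
  moreover have "(3 * k + 1) div 3 = k" "(3 * k + 2) div 3 = k" "(3 * k + 3) div 3 = k + 1"
    by presburger+
  ultimately have "(\<Sum>i<3 * Suc k. (i + 1) div 3) = (\<Sum>i<3 * k. (i + 1) div 3) + (3 * k + 1)"
    by linarith
  then show ?case using Suc by (simp add: algebra_simps)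
qed simp

theorem proposition4p12:
  fixes G :: "'a pair_pre_digraph" and n k :: nat
  assumes "n \<ge> 1" and "path_graph n G"
  shows "(n = 3 * k \<longrightarrow> domination_index G = k * (3 * k + 2)) \<and>
         (n = 3 * k + 1 \<longrightarrow> domination_index G = (3 * k + 1) * (k + 1)) \<and>
         (n = 3 * k + 2 \<longrightarrow> domination_index G = k * (k + 2) + 2 * (k + 1)^2)"
proof -
  obtain vs where "numbered_path G vs n"
    using assms(2) unfolding path_graph_def numbered_path_def by blast
  then have index: "domination_index G = n + 2 * (\<Sum>i<n. (i + 1) div 3)"
    by (rule numbered_path.domination_index_eq)
  have "(3 * k + 1) div 3 = k" "(3 * k + 2) div 3 = k" by presburger+
  then show ?thesis
    unfolding index using sum_Suc_div_3[of k] by (auto simp: algebra_simps power2_eq_square)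
qed

end
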